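(* Let $G$ be a nice $2$-degenerate graph. Then, for every set $W$ of $|E(G)|+4$ distinct strictly positive integers, there exists an edge-injective neighbour-sum-distinguishing $W$-edge-weighting of $G$. In particular, $\chi^{e,1}_\Sigma(G)\leq |E(G)|+4$.
   Context: All graphs are finite, simple, undirected and loopless. A graph is nice if none of its connected components is isomorphic to $K_2$. A graph is $2$-degenerate if every subgraph has a vertex of degree at most $2$. For a set $W$ of weights, a $W$-edge-weighting of $G$ is a map $w:E(G)\to W$; a $k$-edge-weighting is a $\{1,\dots,k\}$-edge-weighting. For a vertex $v$, $\sigma_w(v)=\sum_{u\in N(v)} w(vu)$. The weighting $w$ is neighbour-sum-distinguishing if $\sigma_w(u)\neq\sigma_w(v)$ for every edge $uv$, and edge-injective if no two distinct edges receive the same weight. For a nice graph $G$, $\chi^{e,1}_\Sigma(G)$ is the smallest $k$ such that $G$ admits an edge-injective neighbour-sum-distinguishing $k$-edge-weighting. *)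

theory Defs
  imports Main "HOL-Library.FuncSet"
begin

text \<open>A graph is a pair of a vertex set and a set of edges, an edge being a two-element set of
  vertices; so there are no loops and no parallel edges.\<close>

type_synonym 'a graph = "'a set \<times> 'a set set"

abbreviation verts :: "'a graph \<Rightarrow> 'a set" where
  "verts G \<equiv> fst G"

abbreviation edges :: "'a graph \<Rightarrow> 'a set set" where
  "edges G \<equiv> snd G"

definition simple_graph :: "'a graph \<Rightarrow> bool" where
  "simple_graph G \<longleftrightarrow> finite (verts G) \<and> (\<forall>e\<in>edges G. e \<subseteq> verts G \<and> card e = 2)"

definition subgraph :: "'a graph \<Rightarrow> 'a graph \<Rightarrow> bool" where
  "subgraph H G \<longleftrightarrow> simple_graph H \<and> verts H \<subseteq> verts G \<and> edges H \<subseteq> edges G"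

definition induced_subgraph :: "'a graph \<Rightarrow> 'a set \<Rightarrow> 'a graph" where
  "induced_subgraph G S = (S, {e \<in> edges G. e \<subseteq> S})"

definition neighbours :: "'a graph \<Rightarrow> 'a \<Rightarrow> 'a set" where
  "neighbours G v = {u. {v, u} \<in> edges G}"

definition degree :: "'a graph \<Rightarrow> 'a \<Rightarrow> nat" where
  "degree G v = card (neighbours G v)"

definition reachable :: "'a graph \<Rightarrow> 'a \<Rightarrow> 'a \<Rightarrow> bool" where
  "reachable G = (\<lambda>u v. {u, v} \<in> edges G)\<^sup>*\<^sup>*"

definition connected_components :: "'a graph \<Rightarrow> 'a graph set" where
  "connected_components G = (\<lambda>v. induced_subgraph G {u. reachable G v u}) ` verts G"

definition isomorphic :: "'a graph \<Rightarrow> 'b graph \<Rightarrow> bool" where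
  "isomorphic G H \<longleftrightarrow> (\<exists>f. bij_betw f (verts G) (verts H) \<and>
     (\<forall>u\<in>verts G. \<forall>v\<in>verts G. {u, v} \<in> edges G \<longleftrightarrow> {f u, f v} \<in> edges H))"

definition complete_graph :: "nat \<Rightarrow> nat graph" where
  "complete_graph n = ({..<n}, {e. e \<subseteq> {..<n} \<and> card e = 2})"

definition nice :: "'a graph \<Rightarrow> bool" where
  "nice G \<longleftrightarrow> (\<forall>C\<in>connected_components G. \<not> isomorphic C (complete_graph 2))"

text \<open>The subgraph without vertices has to be excluded here: it has no vertex of any degree.\<close>

definition degenerate :: "nat \<Rightarrow> 'a graph \<Rightarrow> bool" where
  "degenerate d G \<longleftrightarrow>
     (\<forall>H. subgraph H G \<and> verts H \<noteq> {} \<longrightarrow> (\<exists>v\<in>verts H. degree H v \<le> d))"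

text \<open>Weightings are total functions; only their values on the edges matter.\<close>

definition edge_weighting :: "int set \<Rightarrow> 'a graph \<Rightarrow> ('a set \<Rightarrow> int) \<Rightarrow> bool" where
  "edge_weighting W G w \<longleftrightarrow> w \<in> edges G \<rightarrow> W"

definition weight_sum :: "'a graph \<Rightarrow> ('a set \<Rightarrow> int) \<Rightarrow> 'a \<Rightarrow> int" where
  "weight_sum G w v = (\<Sum>u\<in>neighbours G v. w {v, u})"

definition neighbour_sum_distinguishing :: "'a graph \<Rightarrow> ('a set \<Rightarrow> int) \<Rightarrow> bool" where
  "neighbour_sum_distinguishing G w \<longleftrightarrow>
     (\<forall>u v. {u, v} \<in> edges G \<longrightarrow> weight_sum G w u \<noteq> weight_sum G w v)"

definition edge_injective :: "'a graph \<Rightarrow> ('a set \<Rightarrow> int) \<Rightarrow> bool" where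
  "edge_injective G w \<longleftrightarrow> inj_on w (edges G)"

text \<open>The least number below is unspecified if no suitable weighting exists for any \<open>k\<close>.\<close>

definition chi_sum_e1 :: "'a graph \<Rightarrow> nat" where
  "chi_sum_e1 G = (LEAST k. \<exists>w. edge_weighting {1..int k} G w \<and>
     edge_injective G w \<and> neighbour_sum_distinguishing G w)"

end

theory Submission
  imports Defs
begin

text \<open>
  Induction on the number of edges: a set \<open>F\<close> of edges is removed, the rest is weighted with all but
  the \<open>card F\<close> largest weights, and \<open>F\<close> is then weighted with the \<open>card F + 4\<close> unused weights.
  To keep the induction free of niceness, isolated edges are exempt from being distinguished.

  Let \<open>H\<close> be the set of vertices of degree at least 3, and \<open>A\<close> the set of vertices of \<open>H\<close> with at most
  two neighbours in \<open>H\<close>. Greedy choices, and the fact that a large weight at \<open>u\<close> makes the sum at \<open>u\<close>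
  exceed that of any neighbour of degree at most 2, reduce to the case in which every \<open>u\<close> in \<open>A\<close> has
  degree 3 and exactly one neighbour of degree at most 2. By 2-degeneracy some \<open>t\<close> in \<open>H - A\<close> has at
  most two neighbours in \<open>H - A\<close>; all its other neighbours have degree at most 3. Two of the largest
  weights on edges from \<open>t\<close> to such neighbours make the sum at \<open>t\<close> exceed the sums at all of these, and
  there is enough freedom to avoid the two sums at the neighbours in \<open>H - A\<close>.
\<close>

section \<open>Edge sets, neighbourhoods and sums of weights\<close>

definition edge_set :: "'a set set \<Rightarrow> bool" where
  "edge_set E \<longleftrightarrow> finite E \<and> (\<forall>e\<in>E. card e = 2)"

definition nbrs :: "'a set set \<Rightarrow> 'a \<Rightarrow> 'a set" where
  "nbrs E v = {u. {v, u} \<in> E}"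

definition wsum :: "'a set set \<Rightarrow> ('a set \<Rightarrow> int) \<Rightarrow> 'a \<Rightarrow> int" where
  "wsum E w v = (\<Sum>u\<in>nbrs E v. w {v, u})"

definition distinguishing_off :: "'a set \<Rightarrow> 'a set set \<Rightarrow> ('a set \<Rightarrow> int) \<Rightarrow> bool" where
  "distinguishing_off Z E w \<longleftrightarrow> (\<forall>p q. {p, q} \<in> E \<longrightarrow> p \<notin> Z \<longrightarrow> q \<notin> Z \<longrightarrow>
     wsum E w p \<noteq> wsum E w q \<or> (nbrs E p = {q} \<and> nbrs E q = {p}))"

text \<open>\<open>Z\<close> collects the vertices some of whose edges are still to be inserted.\<close>

definition partial_weighting :: "int set \<Rightarrow> 'a set set \<Rightarrow> ('a set \<Rightarrow> int) \<Rightarrow> 'a set \<Rightarrow> bool" where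
  "partial_weighting W E w Z \<longleftrightarrow> w ` E \<subseteq> W \<and> inj_on w E \<and> distinguishing_off Z E w"

text \<open>\<open>W\<close> is quantified here so that a smaller edge set can be weighted from a
  chosen part of the given weights.\<close>

definition solvable :: "'a set set \<Rightarrow> bool" where
  "solvable E \<longleftrightarrow> (\<forall>W. finite W \<longrightarrow> (\<forall>x\<in>W. 0 < x) \<longrightarrow> card W = card E + 4 \<longrightarrow>
     (\<exists>w. partial_weighting W E w {}))"

lemma edge_set_subset: "edge_set E \<Longrightarrow> F \<subseteq> E \<Longrightarrow> edge_set F"
  unfolding edge_set_def by (meson finite_subset subset_iff)

lemma edge_set_insert: "edge_set E \<Longrightarrow> p \<noteq> q \<Longrightarrow> edge_set (insert {p, q} E)"
  unfolding edge_set_def by auto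

lemma edge_set_neq: "edge_set E \<Longrightarrow> {p, q} \<in> E \<Longrightarrow> p \<noteq> q"
  unfolding edge_set_def by force

lemma card_remove_edge: "edge_set E \<Longrightarrow> e \<in> E \<Longrightarrow> card E = card (E - {e}) + 1"
  unfolding edge_set_def using card.remove[of E e] by linarith

lemma finite_nbrs:
  assumes "edge_set E"
  shows "finite (nbrs E v)"
proof -
  have "finite (\<Union>E)"
    using assms unfolding edge_set_def by (metis card.infinite finite_Union zero_neq_numeral)
  then show ?thesis
    by (rule rev_finite_subset) (auto simp: nbrs_def)
qed

lemma card_nbrs_mono: "edge_set E \<Longrightarrow> F \<subseteq> E \<Longrightarrow> card (nbrs F v) \<le> card (nbrs E v)"
  by (rule card_mono[OF finite_nbrs]) (auto simp: nbrs_def)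

lemma nbrs_insert:
  assumes "p \<noteq> q"
  shows "nbrs (insert {p, q} E) v =
    (if v = p then insert q (nbrs E p) else if v = q then insert p (nbrs E q) else nbrs E v)"
  using assms by (auto simp: nbrs_def doubleton_eq_iff)

lemma nbrs_remove:
  assumes "p \<noteq> q"
  shows "nbrs (E - {{p, q}}) v =
    (if v = p then nbrs E p - {q} else if v = q then nbrs E q - {p} else nbrs E v)"
  using assms by (auto simp: nbrs_def doubleton_eq_iff)

lemma card_nbrs_remove:
  assumes "edge_set E" "{p, q} \<in> E"
  shows "card (nbrs (E - {{p, q}}) v) = (if v = p \<or> v = q then card (nbrs E v) - 1 else card (nbrs E v))"
proof -
  have "p \<noteq> q" "q \<in> nbrs E p" "p \<in> nbrs E q"
    using edge_set_neq[OF assms] assms(2) by (auto simp: nbrs_def insert_commute)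
  then show ?thesis
    by (auto simp: nbrs_remove card_Diff_singleton)
qed

lemma wsum_insert:
  assumes "edge_set E" "p \<noteq> q" "{p, q} \<notin> E"
  shows "wsum (insert {p, q} E) (w({p, q} := a)) v = wsum E w v + (if v = p \<or> v = q then a else 0)"
proof -
  let ?w = "w({p, q} := a)"
  have *: "(\<Sum>u\<in>nbrs E x. ?w {x, u}) = wsum E w x" for x
    using assms(3) unfolding wsum_def by (intro sum.cong) (auto simp: nbrs_def)
  have n: "q \<notin> nbrs E p" "p \<notin> nbrs E q"
    using assms(3) by (auto simp: nbrs_def insert_commute)
  consider "v = p" | "v = q" | "v \<noteq> p" "v \<noteq> q" by blast
  then show ?thesis
  proof cases
    case 1
    have "wsum (insert {p, q} E) ?w p = ?w {p, q} + (\<Sum>u\<in>nbrs E p. ?w {p, u})"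
      unfolding wsum_def nbrs_insert[OF assms(2)]
      using n finite_nbrs[OF assms(1)] by (simp del: fun_upd_apply)
    with 1 show ?thesis unfolding * by simp
  next
    case 2
    have "wsum (insert {p, q} E) ?w q = ?w {q, p} + (\<Sum>u\<in>nbrs E q. ?w {q, u})"
      unfolding wsum_def nbrs_insert[OF assms(2)]
      using n assms(2) finite_nbrs[OF assms(1)] by (simp del: fun_upd_apply)
    with 2 show ?thesis unfolding * by (simp add: insert_commute)
  next
    case 3
    then have "wsum (insert {p, q} E) ?w v = (\<Sum>u\<in>nbrs E v. ?w {v, u})"
      unfolding wsum_def nbrs_insert[OF assms(2)] by (simp del: fun_upd_apply)
    with 3 show ?thesis unfolding * by simp
  qed
qed

section \<open>Inserting one edge into a partial weighting\<close>

lemma distinguishing_off_mono: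
  "distinguishing_off Z E w \<Longrightarrow> Z \<subseteq> Z' \<Longrightarrow> distinguishing_off Z' E w"
  unfolding distinguishing_off_def by blast

lemma partial_weighting_mono:
  "partial_weighting W E w Z \<Longrightarrow> Z \<subseteq> Z' \<Longrightarrow> partial_weighting W E w Z'"
  unfolding partial_weighting_def using distinguishing_off_mono by blast

text \<open>The new weight raises the sums at \<open>p\<close> and \<open>q\<close> equally, so
  whether these two differ is settled before \<open>a\<close> is chosen. Only the other edges at
  \<open>p\<close> and \<open>q\<close> restrict \<open>a\<close>, and only those with both ends
  outside \<open>Z\<close>.\<close>

lemma partial_weighting_insert:
  assumes E: "edge_set E" "p \<noteq> q" "{p, q} \<notin> E"
    and w: "partial_weighting W E w (Z \<union> {p, q})"
    and a: "a \<in> W" "a \<notin> w ` E"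
    and p: "\<And>r. p \<notin> Z \<Longrightarrow> r \<in> nbrs E p \<Longrightarrow> r \<notin> Z \<Longrightarrow> wsum E w r \<noteq> wsum E w p + a"
    and q: "\<And>r. q \<notin> Z \<Longrightarrow> r \<in> nbrs E q \<Longrightarrow> r \<notin> Z \<Longrightarrow> wsum E w r \<noteq> wsum E w q + a"
    and pq: "p \<notin> Z \<Longrightarrow> q \<notin> Z \<Longrightarrow>
      wsum E w p \<noteq> wsum E w q \<or> nbrs E p = {} \<and> nbrs E q = {}"
  shows "partial_weighting W (insert {p, q} E) (w({p, q} := a)) Z"
proof -
  let ?E = "insert {p, q} E" and ?w = "w({p, q} := a)"
  note ws = wsum_insert[OF E, of w a]
  have "wsum ?E ?w x \<noteq> wsum ?E ?w y \<or> (nbrs ?E x = {y} \<and> nbrs ?E y = {x})"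
    if xy: "{x, y} \<in> ?E" "x \<notin> Z" "y \<notin> Z" for x y
  proof (cases "{x, y} = {p, q}")
    case True
    then show ?thesis
      using pq that E(2) by (auto simp: ws nbrs_insert doubleton_eq_iff)
  next
    case False
    then have xyE: "{x, y} \<in> E" using xy(1) by simp
    then have nb: "y \<in> nbrs E x" "x \<in> nbrs E y" by (auto simp: nbrs_def insert_commute)
    \<comment> \<open>An old edge meeting \<open>p\<close> or \<open>q\<close> is no longer isolated
      once \<open>{p, q}\<close> is present, so its ends need different sums even if it was exempt
      before.\<close>
    consider "x \<in> {p, q}" | "x \<notin> {p, q}" "y \<in> {p, q}" | "x \<notin> {p, q}" "y \<notin> {p, q}"
      by blast
    then show ?thesis
    proof cases
      case 1
      then have "y \<notin> {p, q}" using False edge_set_neq[OF E(1) xyE] by (auto simp: insert_commute)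
      then show ?thesis using 1 p[of y] q[of y] nb xy unfolding ws by auto
    next
      case 2
      then show ?thesis using p[of x] q[of x] nb xy unfolding ws by auto
    next
      case 3
      then have "wsum E w x \<noteq> wsum E w y \<or> (nbrs E x = {y} \<and> nbrs E y = {x})"
        using w xyE xy unfolding partial_weighting_def distinguishing_off_def by blast
      then show ?thesis using 3 E(2) by (auto simp: ws nbrs_insert)
    qed
  qed
  then have "distinguishing_off Z ?E ?w"
    unfolding distinguishing_off_def by blast
  moreover have "?w ` ?E \<subseteq> W"
    using w a by (auto simp: partial_weighting_def)
  moreover have "inj_on ?w ?E"
    using w a E(3) by (auto simp: partial_weighting_def inj_on_def image_iff)
  ultimately show ?thesis by (simp add: partial_weighting_def)
qed

lemma ex_unused:
  assumes "finite W" "finite B" "finite E" "w ` E \<subseteq> W" "inj_on w E" "card E + card B < card W"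
  shows "\<exists>a\<in>W. a \<notin> w ` E \<and> a \<notin> B"
proof -
  have "card (w ` E \<union> B) < card W"
    using card_Un_le[of "w ` E" B] card_image[OF assms(5)] assms(6) by linarith
  then have "\<not> W \<subseteq> w ` E \<union> B"
    using assms by (metis card_mono finite_UnI finite_imageI not_less)
  then show ?thesis by blast
qed

text \<open>Each old neighbour of an end outside \<open>Z\<close> forbids at most one weight, the
  difference of two current sums, so counting leaves a usable one. \<open>B\<close> holds further
  values to be avoided for the sake of later insertions.\<close>

lemma partial_weighting_extend:
  assumes E: "edge_set E" "p \<noteq> q" "{p, q} \<notin> E"
    and w: "partial_weighting W E w (Z \<union> {p, q})"
    and W: "finite W" and B: "finite B"
    and pq: "p \<notin> Z \<Longrightarrow> q \<notin> Z \<Longrightarrow>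
      wsum E w p \<noteq> wsum E w q \<or> nbrs E p = {} \<and> nbrs E q = {}"
    and card: "card E + card B + (if p \<in> Z then 0 else card (nbrs E p)) +
      (if q \<in> Z then 0 else card (nbrs E q)) < card W"
  shows "\<exists>a\<in>W. a \<notin> w ` E \<and> a \<notin> B \<and>
    partial_weighting W (insert {p, q} E) (w({p, q} := a)) Z"
proof -
  define C where "C v = (if v \<in> Z then {} else (\<lambda>r. wsum E w r - wsum E w v) ` nbrs E v)" for v
  have fin: "finite (C v)" for v
    using finite_nbrs[OF E(1)] by (simp add: C_def)
  have C: "card (C v) \<le> (if v \<in> Z then 0 else card (nbrs E v))" for v
    using finite_nbrs[OF E(1)] by (simp add: C_def card_image_le)
  have "card (B \<union> C p \<union> C q) \<le> card B + card (C p) + card (C q)"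
    using card_Un_le[of "B \<union> C p" "C q"] card_Un_le[of B "C p"] by linarith
  with C[of p] C[of q] card have *: "card E + card (B \<union> C p \<union> C q) < card W"
    by linarith
  obtain a where a: "a \<in> W" "a \<notin> w ` E" "a \<notin> B \<union> C p \<union> C q"
    using ex_unused[OF W _ _ _ _ *, of w] fin B E(1) w
    unfolding partial_weighting_def edge_set_def by blast
  have "partial_weighting W (insert {p, q} E) (w({p, q} := a)) Z"
    by (rule partial_weighting_insert[OF E w a(1,2) _ _ pq])
      (use a(3) in \<open>auto simp: C_def image_iff\<close>)
  with a show ?thesis by blast
qed

section \<open>Bounds on sums, and reserving the largest weights\<close>

lemma wsum_nonneg:
  assumes "\<forall>e\<in>E. 0 < w e"
  shows "0 \<le> wsum E w v"
  unfolding wsum_def by (intro sum_nonneg) (use assms in \<open>force simp: nbrs_def\<close>)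

lemma wsum_ge:
  assumes "edge_set E" "\<forall>e\<in>E. 0 < w e" "{v, r} \<in> E"
  shows "w {v, r} \<le> wsum E w v"
  unfolding wsum_def using assms finite_nbrs[OF assms(1)]
  by (intro member_le_sum[of r _ "\<lambda>u. w {v, u}"]) (auto simp: nbrs_def intro: less_imp_le)

lemma wsum_le:
  assumes "\<forall>e\<in>E. w e \<le> N"
  shows "wsum E w v \<le> int (card (nbrs E v)) * N"
  unfolding wsum_def using sum_bounded_above[of "nbrs E v" "\<lambda>u. w {v, u}" N] assms
  by (auto simp: nbrs_def)

text \<open>The weight of \<open>{v, r}\<close> is kept exact because it also occurs in the sum at
  \<open>r\<close>: it cancels when the two ends are compared.\<close>

lemma wsum_le_edge:
  assumes "edge_set E" "\<forall>e\<in>E. w e \<le> N" "{v, r} \<in> E"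
  shows "wsum E w v \<le> w {v, r} + int (card (nbrs E v) - 1) * N"
proof -
  have r: "r \<in> nbrs E v" using assms(3) by (simp add: nbrs_def)
  have "wsum E w v = w {v, r} + (\<Sum>u\<in>nbrs E v - {r}. w {v, u})"
    unfolding wsum_def using finite_nbrs[OF assms(1)] r by (simp add: sum.remove)
  also have "(\<Sum>u\<in>nbrs E v - {r}. w {v, u}) \<le> int (card (nbrs E v - {r})) * N"
    using sum_bounded_above[of "nbrs E v - {r}" "\<lambda>u. w {v, u}" N] assms(2)
    by (auto simp: nbrs_def)
  finally show ?thesis using r by (simp add: card_Diff_singleton)
qed

lemma ex_threshold:
  assumes "finite W" "card W = n + k" "0 < n"
  shows "\<exists>N::int. N \<in> W \<and> card {x \<in> W. x \<le> N} = n \<and> card {x \<in> W. N < x} = k"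
  using assms
proof (induction k arbitrary: W)
  case 0
  let ?N = "Max W"
  have W: "W \<noteq> {}" using 0 by auto
  have 1: "{x \<in> W. x \<le> ?N} = W" and 2: "{x \<in> W. ?N < x} = {}"
    by (auto dest: Max_ge[OF 0(1)])
  have "card {x \<in> W. x \<le> ?N} = n" "card {x \<in> W. ?N < x} = 0"
    unfolding 1 2 using 0(2) by auto
  with Max_in[OF 0(1) W] show ?case by (intro exI[of _ ?N] conjI)
next
  case (Suc k)
  let ?M = "Max W"
  have "W \<noteq> {}" using Suc.prems by auto
  with Suc.prems(1) have M: "?M \<in> W" by (rule Max_in)
  have "card (W - {?M}) = n + k" using Suc.prems(2) card_Diff_singleton[OF M] by linarith
  then obtain N where N: "N \<in> W - {?M}" "card {x \<in> W - {?M}. x \<le> N} = n"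
    "card {x \<in> W - {?M}. N < x} = k"
    using Suc.IH[of "W - {?M}"] Suc.prems by blast
  have lt: "N < ?M" using N(1) Max_ge[OF Suc.prems(1), of N] by simp
  have 1: "{x \<in> W. x \<le> N} = {x \<in> W - {?M}. x \<le> N}"
    using lt by force
  have 2: "{x \<in> W. N < x} = insert ?M {x \<in> W - {?M}. N < x}"
    using lt M by blast
  have "card {x \<in> W. x \<le> N} = n" "card {x \<in> W. N < x} = Suc k"
    unfolding 1 2 using N Suc.prems(1) by auto
  with N(1) show ?case by blast
qed

lemma solvable_top_free:
  assumes "solvable F" "finite W" "\<forall>x\<in>W. 0 < x" "card W = card F + k + 4"
  obtains w N where "0 < N" "partial_weighting W F w {}" "\<forall>e\<in>F. 0 < w e"
    "\<forall>e\<in>F. w e \<le> N" "card {x \<in> W. N < x} = k"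
proof -
  obtain N where N: "N \<in> W" "card {x \<in> W. x \<le> N} = card F + 4" "card {x \<in> W. N < x} = k"
    using ex_threshold[of W "card F + 4" k] assms by auto
  obtain w where w: "partial_weighting {x \<in> W. x \<le> N} F w {}"
    using assms(1-3) N(2) unfolding solvable_def
    by (metis (no_types, lifting) finite_subset mem_Collect_eq subsetI)
  show thesis
  proof (rule that[of N w])
    show "partial_weighting W F w {}" using w by (auto simp: partial_weighting_def)
  qed (use w N assms(3) in \<open>auto simp: partial_weighting_def\<close>)
qed

section \<open>Reductions at vertices of small degree\<close>

lemma wsum_eq_0: "nbrs E v = {} \<Longrightarrow> wsum E w v = 0"
  by (simp add: wsum_def)

lemma wsum_pos:
  assumes "edge_set E" "\<forall>e\<in>E. 0 < w e" "nbrs E v \<noteq> {}"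
  shows "0 < wsum E w v"
  unfolding wsum_def using assms finite_nbrs[OF assms(1)]
  by (intro sum_pos) (auto simp: nbrs_def)

text \<open>Either one sum is zero and the other positive, or both are single weights. In the latter
  case they belong to different edges, \<open>p\<close> and \<open>q\<close> not being adjacent, and
  \<open>w\<close> is injective.\<close>

lemma wsum_neq_low:
  assumes E: "edge_set E" "\<forall>e\<in>E. 0 < w e" "inj_on w E" "{p, q} \<notin> E" "p \<noteq> q"
    and q: "card (nbrs E q) \<le> 1" and p: "card (nbrs E p) \<le> 1 \<or> nbrs E q = {}"
  shows "wsum E w p \<noteq> wsum E w q \<or> nbrs E p = {} \<and> nbrs E q = {}"
proof (cases "nbrs E p = {} \<or> nbrs E q = {}")
  case True
  then show ?thesis
    using wsum_pos[OF E(1,2), of p] wsum_pos[OF E(1,2), of q] wsum_eq_0[of E p w] wsum_eq_0[of E q w]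
    by (cases "nbrs E p = {}"; cases "nbrs E q = {}") simp_all
next
  case False
  then have "0 < card (nbrs E p)" "0 < card (nbrs E q)"
    using finite_nbrs[OF E(1)] by (simp_all add: card_gt_0_iff)
  with False p q have "card (nbrs E q) = 1" "card (nbrs E p) = 1"
    by linarith+
  then obtain x y where xy: "nbrs E p = {x}" "nbrs E q = {y}"
    by (auto simp: card_1_singleton_iff)
  then have "{p, x} \<in> E" "{q, y} \<in> E" by (auto simp: nbrs_def)
  moreover have "{p, x} \<noteq> {q, y}"
    using E(4,5) calculation by (auto simp: doubleton_eq_iff)
  ultimately have "w {p, x} \<noteq> w {q, y}" using E(3) by (auto dest: inj_onD)
  then show ?thesis by (simp add: wsum_def xy)
qed

lemma solvable_remove_edge:
  assumes E: "edge_set E" "{p, q} \<in> E" and s: "solvable (E - {{p, q}})"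
    and q: "card (nbrs E q) \<le> 2"
    and p: "card (nbrs E p) \<le> 2 \<or> card (nbrs E q) = 1 \<and> card (nbrs E p) \<le> 5"
  shows "solvable E"
  unfolding solvable_def
proof (intro allI impI)
  fix W :: "int set"
  assume W: "finite W" "\<forall>x\<in>W. 0 < x" "card W = card E + 4"
  let ?F = "E - {{p, q}}"
  have pq: "p \<noteq> q" using edge_set_neq[OF E] .
  have F: "edge_set ?F" using E(1) by (rule edge_set_subset) auto
  have cF: "card E = card ?F + 1"
    using card_remove_edge[OF E] .
  have cW: "card W = card ?F + 1 + 4" using W(3) cF by simp
  obtain w N where w: "0 < N" "partial_weighting W ?F w {}" "\<forall>e\<in>?F. 0 < w e"
    "\<forall>e\<in>?F. w e \<le> N" "card {x \<in> W. N < x} = 1"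
    using solvable_top_free[OF s W(1,2) cW] .
  have d: "card (nbrs ?F q) = card (nbrs E q) - 1" "card (nbrs ?F p) = card (nbrs E p) - 1"
    by (simp_all add: card_nbrs_remove[OF E])
  have "wsum ?F w p \<noteq> wsum ?F w q \<or> nbrs ?F p = {} \<and> nbrs ?F q = {}"
  proof (rule wsum_neq_low[OF F w(3)])
    show "inj_on w ?F" using w by (simp add: partial_weighting_def)
    show "card (nbrs ?F p) \<le> 1 \<or> nbrs ?F q = {}"
      using p d finite_nbrs[OF F, of q] by auto
  qed (use pq d q in auto)
  moreover have "card ?F + card ({} :: int set) + card (nbrs ?F p) + card (nbrs ?F q) < card W"
    using d p q W(3) cF by auto
  ultimately obtain a where "partial_weighting W (insert {p, q} ?F) (w({p, q} := a)) {}"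
    using partial_weighting_extend[OF F pq _ partial_weighting_mono[OF w(2)] W(1), of "{}" "{}"]
    by auto
  then show "\<exists>w. partial_weighting W E w {}" using E(2) by (auto simp: insert_absorb)
qed

text \<open>The edge \<open>{a, b}\<close> is inserted first: its weight enters the sum at
  \<open>b\<close> but not the one at \<open>c\<close>, so it can separate these two before
  \<open>{b, c}\<close> is inserted.\<close>

lemma solvable_remove_path:
  assumes E: "edge_set E" "{a, b} \<in> E" "{b, c} \<in> E" "a \<noteq> c"
    and s: "solvable (E - {{b, c}} - {{a, b}})"
    and deg: "card (nbrs E a) \<le> 5" "card (nbrs E b) + card (nbrs E c) \<le> 6"
  shows "solvable E"
  unfolding solvable_def
proof (intro allI impI)
  fix W :: "int set"
  assume W: "finite W" "\<forall>x\<in>W. 0 < x" "card W = card E + 4"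
  let ?G = "E - {{b, c}}"
  let ?F = "?G - {{a, b}}"
  have neq: "a \<noteq> b" "b \<noteq> c" using edge_set_neq[OF E(1)] E by auto
  have ab: "{a, b} \<in> ?G" using E neq by (auto simp: doubleton_eq_iff)
  have G: "edge_set ?G" and F: "edge_set ?F" using E(1) by (auto elim!: edge_set_subset)
  have cF: "card ?G = card ?F + 1" "card E = card ?F + 2"
    using card_remove_edge[OF E(1,3)] card_remove_edge[OF G ab] by linarith+
  have cW: "card W = card ?F + 2 + 4" using W(3) cF by simp
  obtain w N where w: "0 < N" "partial_weighting W ?F w {}" "\<forall>e\<in>?F. 0 < w e"
    "\<forall>e\<in>?F. w e \<le> N" "card {x \<in> W. N < x} = 2"
    using solvable_top_free[OF s W(1,2) cW] .
  have da: "card (nbrs ?F a) \<le> 4"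
    using deg(1) E(4) neq by (simp add: card_nbrs_remove[OF G ab] card_nbrs_remove[OF E(1,3)])
  have "c \<in> nbrs E b" "b \<in> nbrs E c"
    using E(3) by (simp_all add: nbrs_def insert_commute)
  then have pos: "0 < card (nbrs E b)" "0 < card (nbrs E c)"
    using finite_nbrs[OF E(1)] by (auto simp: card_gt_0_iff)
  have dbc: "card (nbrs ?G b) + card (nbrs ?G c) \<le> 4"
    using deg(2) pos by (simp add: card_nbrs_remove[OF E(1,3)])
  obtain x where x: "x \<notin> {wsum ?F w c - wsum ?F w b}"
      "partial_weighting W (insert {a, b} ?F) (w({a, b} := x)) {b, c}"
    using partial_weighting_extend[OF F neq(1) _ partial_weighting_mono[OF w(2)] W(1),
        of "{b, c}" "{wsum ?F w c - wsum ?F w b}"] E(4) neq da W(3) cF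
    by auto
  let ?w = "w({a, b} := x)"
  have G_eq: "insert {a, b} ?F = ?G" using ab by blast
  have "wsum (insert {a, b} ?F) ?w b \<noteq> wsum (insert {a, b} ?F) ?w c"
    using x(1) E(4) neq by (subst (1 2) wsum_insert[OF F neq(1)]) auto
  then have ne: "wsum ?G ?w b \<noteq> wsum ?G ?w c"
    unfolding G_eq .
  have "partial_weighting W ?G ?w ({} \<union> {b, c})" using x(2) unfolding G_eq by simp
  then obtain y where "partial_weighting W (insert {b, c} ?G) (?w({b, c} := y)) {}"
    using partial_weighting_extend[OF G neq(2), of W ?w "{}" "{}"] ne dbc W cF by auto
  then show "\<exists>w. partial_weighting W E w {}" using E(3) by (auto simp: insert_absorb)
qed

text \<open>A weight above \<open>N\<close> on \<open>{u, v}\<close> puts the sum at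
  \<open>u\<close> above that of every neighbour of degree at most 2 other than \<open>v\<close>.
  What is left to avoid is \<open>v\<close>, the set \<open>X\<close> of possible exceptions, and
  the other neighbour of \<open>v'\<close>.\<close>

lemma solvable_remove_two_low:
  assumes E: "edge_set E" "{u, v} \<in> E" "{u, v'} \<in> E" "v \<noteq> v'"
    and s: "solvable (E - {{u, v'}} - {{u, v}})"
    and low: "card (nbrs E v) \<le> 2" "card (nbrs E v') \<le> 2"
    and X: "finite X" "card X \<le> 2" "\<And>r. r \<in> nbrs E u \<Longrightarrow> r \<notin> X \<Longrightarrow> card (nbrs E r) \<le> 2"
  shows "solvable E"
  unfolding solvable_def
proof (intro allI impI)
  fix W :: "int set"
  assume W: "finite W" "\<forall>x\<in>W. 0 < x" "card W = card E + 4"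
  let ?G = "E - {{u, v'}}"
  let ?F = "?G - {{u, v}}"
  have neq: "u \<noteq> v" "u \<noteq> v'" using edge_set_neq[OF E(1)] E by auto
  have uv: "{u, v} \<in> ?G" using E neq by (auto simp: doubleton_eq_iff)
  have G: "edge_set ?G" and F: "edge_set ?F" using E(1) by (auto elim!: edge_set_subset)
  have cF: "card ?G = card ?F + 1" "card E = card ?F + 2"
    using card_remove_edge[OF E(1,3)] card_remove_edge[OF G uv] by linarith+
  have G_eq: "insert {u, v} ?F = ?G" using uv by blast
  have cW: "card W = card ?F + 2 + 4" using W(3) cF by simp
  obtain w N where w: "0 < N" "partial_weighting W ?F w {}" "\<forall>e\<in>?F. 0 < w e"
    "\<forall>e\<in>?F. w e \<le> N" "card {x \<in> W. N < x} = 2"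
    using solvable_top_free[OF s W(1,2) cW] .
  have dv: "card (nbrs ?F v) \<le> 1" "card (nbrs ?F v') \<le> 1" "card (nbrs ?G v') \<le> 1"
    using low E(4) neq by (simp_all add: card_nbrs_remove[OF G uv] card_nbrs_remove[OF E(1,3)])
  have dr: "card (nbrs ?F r) \<le> 2" if "r \<in> nbrs ?F u" "r \<notin> X" for r
  proof -
    have "r \<in> nbrs E u" using that(1) by (auto simp: nbrs_def)
    with X(3) that(2) have "card (nbrs E r) \<le> 2" by blast
    moreover have "card (nbrs ?F r) \<le> card (nbrs E r)"
      by (rule card_nbrs_mono[OF E(1)]) auto
    ultimately show ?thesis by linarith
  qed
  let ?A = "(\<lambda>r. wsum ?F w r - wsum ?F w v) ` nbrs ?F v"
  have "card ?A \<le> 1" using dv(1) card_image_le[OF finite_nbrs[OF F]] le_trans by blast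
  \<comment> \<open>Two weights above \<open>N\<close> are free, and \<open>v\<close> has at most
    one other neighbour to conflict with.\<close>
  then have "\<not> {x \<in> W. N < x} \<subseteq> ?A"
    using w(5) card_mono[of ?A "{x \<in> W. N < x}"] finite_nbrs[OF F, of v] by auto
  then obtain a where a: "a \<in> W" "N < a" "a \<notin> ?A" by blast
  have aF: "a \<notin> w ` ?F" using a(2) w(4) by force
  let ?w = "w({u, v} := a)"
  have w1: "partial_weighting W ?G ?w {u, v'}"
  proof -
    have "partial_weighting W (insert {u, v} ?F) ?w {u, v'}"
      by (rule partial_weighting_insert[OF F neq(1) _ partial_weighting_mono[OF w(2)] a(1) aF])
        (use a(3) in \<open>auto simp: image_iff\<close>)
    then show ?thesis unfolding G_eq .
  qed
  have ws: "wsum ?G ?w x = wsum ?F w x + (if x = u \<or> x = v then a else 0)" for x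
    using wsum_insert[OF F neq(1), of w a x] unfolding G_eq by simp
  let ?S = "\<lambda>r. wsum ?G ?w r"
  let ?B = "insert (?S v - ?S u) ((\<lambda>r. ?S r - ?S u) ` X \<union> (\<lambda>r. ?S r - ?S v') ` nbrs ?G v')"
  have "card ((\<lambda>r. ?S r - ?S u) ` X) \<le> 2" "card ((\<lambda>r. ?S r - ?S v') ` nbrs ?G v') \<le> 1"
    using X dv(3) card_image_le[OF X(1)] card_image_le[OF finite_nbrs[OF G]] le_trans by blast+
  then have "card ((\<lambda>r. ?S r - ?S u) ` X \<union> (\<lambda>r. ?S r - ?S v') ` nbrs ?G v') \<le> 3"
    using card_Un_le[of "(\<lambda>r. ?S r - ?S u) ` X" "(\<lambda>r. ?S r - ?S v') ` nbrs ?G v'"] by linarith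
  then have B: "card ?B \<le> 4" "finite ?B"
    using card_insert_le_m1 X(1) finite_nbrs[OF G] by (auto simp: card_insert_if)
  obtain b where b: "b \<in> W" "b \<notin> ?w ` ?G" "b \<notin> ?B"
    using ex_unused[of W ?B ?G ?w] B W cF w1 G unfolding partial_weighting_def edge_set_def by auto
  have "0 < b" using b W by blast
  have "partial_weighting W (insert {u, v'} ?G) (?w({u, v'} := b)) {}"
  proof (rule partial_weighting_insert[OF G neq(2)])
    show "partial_weighting W ?G ?w ({} \<union> {u, v'})" using w1 by simp
    show "?S r \<noteq> ?S u + b" if r: "r \<in> nbrs ?G u" for r
    proof (cases "r = v \<or> r \<in> X")
      case True
      then show ?thesis using b(3) by force
    next
      case False
      have rF: "{u, r} \<in> ?F" and ru: "r \<noteq> u"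
        using r False edge_set_neq[OF E(1), of u r] by (auto simp: nbrs_def doubleton_eq_iff)
      \<comment> \<open>The common weight of \<open>{r, u}\<close> cancels: beside it
        \<open>r\<close> has at most one weight, which is at most \<open>N\<close>, whereas
        \<open>u\<close> also has \<open>a > N\<close>.\<close>
      have "wsum ?F w r \<le> w {r, u} + int (card (nbrs ?F r) - 1) * N"
        by (rule wsum_le_edge[OF F w(4)]) (use rF in \<open>auto simp: insert_commute\<close>)
      also have "\<dots> \<le> w {r, u} + 1 * N"
        using dr[of r] rF False w(1) by (intro add_left_mono mult_right_mono) (auto simp: nbrs_def)
      also have "w {r, u} \<le> wsum ?F w u"
        using wsum_ge[OF F w(3) rF] by (simp add: insert_commute)
      finally have "wsum ?F w r \<le> wsum ?F w u + N" by simp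
      then show ?thesis using False ru a(2) \<open>0 < b\<close> by (simp add: ws)
    qed
    show "?S r \<noteq> ?S v' + b" if "r \<in> nbrs ?G v'" for r
      using b(3) that by force
    have "wsum ?F w v' \<le> int (card (nbrs ?F v')) * N" by (rule wsum_le[OF w(4)])
    also have "\<dots> \<le> 1 * N" using dv(2) w(1) by (intro mult_right_mono) auto
    finally have "?S v' < ?S u"
      using wsum_nonneg[OF w(3), of u] a(2) neq E(4) by (simp add: ws)
    then show "?S u \<noteq> ?S v' \<or> nbrs ?G u = {} \<and> nbrs ?G v' = {}" by simp
  qed (use b in auto)
  then show "\<exists>w. partial_weighting W E w {}" using E(3) by (auto simp: insert_absorb)
qed

section \<open>Reductions at a vertex with at most two exceptional neighbours\<close>

lemma ex_distinct_pair_sum: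
  fixes T D A :: "int set"
  assumes T: "3 \<le> card T" and D: "finite D" "card D \<le> 2" and A: "finite A" "card A \<le> 1"
  shows "\<exists>x\<in>T. \<exists>y\<in>T. x \<noteq> y \<and> y \<notin> A \<and> x + y \<notin> D"
proof -
  obtain S where "S \<subseteq> T" "card S = 3" using obtain_subset_with_card_n[OF T] by blast
  then obtain x y z where xyz: "x \<in> T" "y \<in> T" "z \<in> T" "x \<noteq> y" "y \<noteq> z" "x \<noteq> z"
    by (auto simp: card_3_iff)
  \<comment> \<open>Two pairs from three elements share one element, so different pairs have
    different sums and \<open>D\<close> cannot contain all of them.\<close>
  then have "card {x + y, x + z, y + z} = 3" by auto
  then have "\<not> {x + y, x + z, y + z} \<subseteq> D"
    using card_mono[OF D(1), of "{x + y, x + z, y + z}"] D(2) by linarith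
  then obtain p q where pq: "p \<in> T" "q \<in> T" "p \<noteq> q" "p + q \<notin> D"
    using xyz by blast
  \<comment> \<open>The sum is symmetric, so either element of the pair may be the one that has to
    avoid \<open>A\<close>.\<close>
  have "\<not> {p, q} \<subseteq> A"
    using card_mono[OF A(1), of "{p, q}"] A(2) pq(3) by auto
  then show ?thesis using pq by (metis add.commute empty_subsetI insert_subset)
qed

text \<open>As \<open>b + c\<close> exceeds \<open>2 * N\<close>, the sum at \<open>t\<close> passes
  that of every old neighbour with at most two further edges. The at most two neighbours in
  \<open>X\<close> forbid values of the total \<open>b + c\<close>, so three weights above
  \<open>N\<close> offer enough choice.\<close>

lemma partial_weighting_pivot:
  assumes E: "edge_set E" "{t, g} \<notin> E" "{t, u} \<notin> E" and neq: "t \<noteq> g" "t \<noteq> u" "u \<noteq> g"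
    and w: "partial_weighting W E w {}" "\<forall>e\<in>E. 0 < w e" "\<forall>e\<in>E. w e \<le> N" "0 < N"
    and T: "3 \<le> card {x \<in> W. N < x}"
    and Z: "u \<in> Z" "t \<notin> Z"
    and g: "g \<notin> Z \<Longrightarrow> card (nbrs E g) \<le> 1"
    and X: "finite X" "card X \<le> 2"
      "\<And>r. r \<in> nbrs E t \<Longrightarrow> r \<notin> Z \<Longrightarrow> r \<notin> X \<Longrightarrow> card (nbrs E r) \<le> 3"
  shows "\<exists>b c. N < b \<and> N < c \<and>
    partial_weighting W (insert {t, u} (insert {t, g} E)) (w({t, g} := c, {t, u} := b)) Z"
proof -
  let ?S = "wsum E w"
  \<comment> \<open>\<open>D\<close> holds the totals \<open>b + c\<close> for which
    \<open>t\<close> ties with a member of \<open>X\<close>; \<open>A\<close> holds the values of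
    \<open>c\<close> for which \<open>g\<close> ties with its other neighbour.\<close>
  define D where "D = (\<lambda>r. ?S r - ?S t) ` X"
  define A where "A = (if g \<in> Z then {} else (\<lambda>r. ?S r - ?S g) ` nbrs E g)"
  have "finite D" "card D \<le> 2"
    using X card_image_le[OF X(1)] le_trans unfolding D_def by blast+
  moreover have "finite A" "card A \<le> 1"
    using g card_image_le[OF finite_nbrs[OF E(1)]] le_trans finite_nbrs[OF E(1)]
    unfolding A_def by (auto, blast)
  ultimately obtain b c where bc: "b \<in> W" "N < b" "c \<in> W" "N < c" "b \<noteq> c" "c \<notin> A" "b + c \<notin> D"
    using ex_distinct_pair_sum[OF T] by blast
  have new: "b \<notin> w ` E" "c \<notin> w ` E" using bc(2,4) w(3) by force+
  let ?E = "insert {t, g} E" and ?w = "w({t, g} := c)"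
  have E1: "edge_set ?E" "{t, u} \<notin> ?E"
    using edge_set_insert[OF E(1) neq(1)] E(3) neq by (auto simp: doubleton_eq_iff)
  \<comment> \<open>The sum at \<open>t\<close> is not final yet, so \<open>t\<close> joins
    \<open>Z\<close> for this insertion and \<open>c\<close> only has to suit
    \<open>g\<close>.\<close>
  have w1: "partial_weighting W ?E ?w (insert t Z)"
    by (rule partial_weighting_insert[OF E(1) neq(1) E(2) partial_weighting_mono[OF w(1)] bc(3) new(2)])
      (use bc(6) in \<open>auto simp: A_def image_iff\<close>)
  have ws: "wsum ?E ?w x = ?S x + (if x = t \<or> x = g then c else 0)" for x
    by (rule wsum_insert[OF E(1) neq(1) E(2)])
  have "partial_weighting W (insert {t, u} ?E) (?w({t, u} := b)) Z"
  proof (rule partial_weighting_insert[OF E1(1) neq(2) E1(2)])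
    show "partial_weighting W ?E ?w (Z \<union> {t, u})" using w1 Z by (simp add: insert_absorb)
    show "b \<notin> ?w ` ?E" using new bc(5) E(2) by auto
    show "wsum ?E ?w r \<noteq> wsum ?E ?w t + b" if r: "r \<in> nbrs ?E t" "r \<notin> Z" for r
    proof -
      have rt: "r \<noteq> t" using r(1) edge_set_neq[OF E1(1), of t r] by (auto simp: nbrs_def)
      consider "r = g" | "r \<noteq> g" "r \<in> X" | "r \<noteq> g" "r \<notin> X" by blast
      then show ?thesis
      proof cases
        case 1
        have "?S g \<le> int (card (nbrs E g)) * N" by (rule wsum_le[OF w(3)])
        also have "\<dots> \<le> 1 * N" using g r(2) 1 w(4) by (intro mult_right_mono) auto
        finally show ?thesis
          using 1 neq wsum_nonneg[OF w(2), of t] bc(2) by (simp add: ws)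
      next
        case 2
        then show ?thesis using rt bc(7) by (auto simp: ws D_def image_iff algebra_simps)
      next
        case 3
        have rE: "{t, r} \<in> E" using r(1) 3 rt by (auto simp: nbrs_def doubleton_eq_iff)
        have "?S r \<le> w {r, t} + int (card (nbrs E r) - 1) * N"
          by (rule wsum_le_edge[OF E(1) w(3)]) (use rE in \<open>simp add: insert_commute\<close>)
        also have "\<dots> \<le> w {r, t} + 2 * N"
          using X(3)[of r] rE 3 r(2) w(4) by (intro add_left_mono mult_right_mono) (auto simp: nbrs_def)
        also have "w {r, t} \<le> ?S t"
          using wsum_ge[OF E(1) w(2) rE] by (simp add: insert_commute)
        finally show ?thesis using 3 rt bc(2,4) by (simp add: ws)
      qed
    qed
  qed (use bc Z in auto)
  then show ?thesis using bc by blast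
qed

text \<open>The edges \<open>{t, g}\<close> and \<open>{t, u}\<close> are inserted by
  \<open>partial_weighting_pivot\<close> with \<open>u\<close> and \<open>q\<close> postponed, and
  \<open>{u, q}\<close> then repairs \<open>u\<close> and \<open>q\<close>. The set \<open>Z\<close>
  and the two bounds in the conclusion prepare the insertion of one more edge at
  \<open>g\<close>.\<close>

lemma partial_weighting_add_three:
  assumes K: "edge_set K" "{t, g} \<in> K" "{t, u} \<in> K" "{u, q} \<in> K"
    and neq: "t \<noteq> q" "u \<noteq> g" "g \<noteq> q"
    and deg: "card (nbrs K u) \<le> 3" "card (nbrs K q) \<le> 2"
    and X: "finite X" "card X \<le> 2"
      "\<And>r. r \<in> nbrs K t \<Longrightarrow> r \<notin> Z \<Longrightarrow> r \<notin> X \<Longrightarrow> card (nbrs K r) \<le> 3"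
    and Z: "t \<notin> Z" "u \<notin> Z" "q \<notin> Z" "g \<notin> Z \<Longrightarrow> card (nbrs K g) \<le> 2"
    and W: "finite W" "card K + 3 \<le> card W" "3 \<le> card {x \<in> W. N < x}"
    and w: "partial_weighting W (K - {{u, q}} - {{t, u}} - {{t, g}}) w {}"
      "\<forall>e\<in>K - {{u, q}} - {{t, u}} - {{t, g}}. 0 < w e"
      "\<forall>e\<in>K - {{u, q}} - {{t, u}} - {{t, g}}. w e \<le> N" "0 < N"
  shows "\<exists>w. partial_weighting W K w Z \<and> N < wsum K w g \<and>
    (\<forall>v. v \<notin> {t, u, q, g} \<longrightarrow> card (nbrs K v) \<le> 1 \<longrightarrow> wsum K w v \<le> N)"
proof -
  let ?G = "K - {{u, q}}"
  let ?H = "?G - {{t, u}}"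
  let ?F = "?H - {{t, g}}"
  have neq': "t \<noteq> g" "t \<noteq> u" "u \<noteq> q" using edge_set_neq[OF K(1)] K by auto
  have tu: "{t, u} \<in> ?G" and tg: "{t, g} \<in> ?H"
    using K neq neq' by (auto simp: doubleton_eq_iff)
  have sets: "edge_set ?G" "edge_set ?H" "edge_set ?F" "{t, g} \<notin> ?F" "{t, u} \<notin> ?F" "{t, u} \<notin> ?H"
    using K(1) by (auto elim!: edge_set_subset)
  have eqs: "insert {t, g} ?F = ?H" "insert {t, u} ?H = ?G" "insert {u, q} ?G = K"
    using tu tg K(4) by (simp_all add: insert_absorb)
  have mono: "card (nbrs ?F v) \<le> card (nbrs K v)" for v
    by (rule card_nbrs_mono[OF K(1)]) auto
  have dq: "card (nbrs ?G q) \<le> 1" "card (nbrs ?G u) \<le> 2"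
    using deg by (simp_all add: card_nbrs_remove[OF K(1,4)])
  have "card (nbrs ?F g) \<le> 1" if "g \<notin> Z"
    using Z(4)[OF that] neq neq'
    by (simp add: card_nbrs_remove[OF sets(2) tg] card_nbrs_remove[OF sets(1) tu] card_nbrs_remove[OF K(1,4)])
  moreover have "card (nbrs ?F r) \<le> 3" if "r \<in> nbrs ?F t" "r \<notin> {u, q} \<union> Z" "r \<notin> X" for r
  proof -
    have "r \<in> nbrs K t" using that(1) by (auto simp: nbrs_def)
    then show ?thesis using X(3)[of r] that mono[of r] by auto
  qed
  ultimately obtain b c where bc: "N < b" "N < c"
    "partial_weighting W (insert {t, u} (insert {t, g} ?F)) (w({t, g} := c, {t, u} := b)) ({u, q} \<union> Z)"
    using partial_weighting_pivot[OF sets(3-5) neq'(1,2) neq(2) w W(3), of "{u, q} \<union> Z" X]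
      X(1,2) Z neq neq' by auto
  define w1 where "w1 = w({t, g} := c, {t, u} := b)"
  have pw1: "partial_weighting W ?G w1 (Z \<union> {u, q})"
    using bc(3) unfolding w1_def eqs by (simp only: Un_commute)
  have ws: "wsum ?G w1 x = wsum ?F w x + (if x = t \<or> x = g then c else 0) + (if x = t \<or> x = u then b else 0)" for x
    using wsum_insert[OF sets(3) neq'(1) sets(4), of w c x]
      wsum_insert[OF sets(2) neq'(2) sets(6), of "w({t, g} := c)" b x]
    unfolding eqs w1_def by simp
  have small: "wsum ?F w v \<le> N" if "card (nbrs ?G v) \<le> 1" for v
  proof -
    have "card (nbrs ?F v) \<le> card (nbrs ?G v)"
      by (rule card_nbrs_mono[OF sets(1)]) auto
    then have "card (nbrs ?F v) \<le> 1" using that by linarith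
    then have "int (card (nbrs ?F v)) * N \<le> 1 * N" using w(4) by (intro mult_right_mono) auto
    with wsum_le[OF w(3), of v] show ?thesis by linarith
  qed
  have nonneg: "0 \<le> wsum ?F w v" for v by (rule wsum_nonneg[OF w(2)])
  \<comment> \<open>\<open>u\<close> already carries \<open>b > N\<close>, whereas \<open>q\<close>
    has at most one edge so far, of weight at most \<open>N\<close>.\<close>
  have "wsum ?G w1 u \<noteq> wsum ?G w1 q"
    using small[OF dq(1)] nonneg[of u] bc(1) neq neq' by (simp add: ws)
  moreover have "card ?G + card ({} :: int set) + card (nbrs ?G u) + card (nbrs ?G q) < card W"
    using dq W(2) card_remove_edge[OF K(1,4)] by simp
  ultimately obtain a where a: "partial_weighting W (insert {u, q} ?G) (w1({u, q} := a)) Z"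
    using partial_weighting_extend[OF sets(1) neq'(3) _ pw1 W(1), of "{}"] Z by auto
  have ws2: "wsum K (w1({u, q} := a)) x = wsum ?G w1 x + (if x = u \<or> x = q then a else 0)" for x
    using wsum_insert[OF sets(1) neq'(3), of w1 a x] unfolding eqs by simp
  have "N < wsum K (w1({u, q} := a)) g"
    using nonneg[of g] bc(2) neq neq' by (simp add: ws ws2)
  moreover have "wsum K (w1({u, q} := a)) v \<le> N"
    if "v \<notin> {t, u, q, g}" "card (nbrs K v) \<le> 1" for v
    using small[of v] that by (simp add: ws ws2 card_nbrs_remove[OF K(1,4)])
  ultimately show ?thesis using a unfolding eqs by blast
qed

text \<open>Here \<open>g\<close> has at most one edge besides \<open>{t, g}\<close>, so nothing has
  to be postponed.\<close>

lemma solvable_remove_three: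
  assumes E: "edge_set E" "{t, g} \<in> E" "{t, u} \<in> E" "{u, q} \<in> E"
    and neq: "t \<noteq> q" "u \<noteq> g" "g \<noteq> q"
    and s: "solvable (E - {{u, q}} - {{t, u}} - {{t, g}})"
    and deg: "card (nbrs E u) \<le> 3" "card (nbrs E q) \<le> 2" "card (nbrs E g) \<le> 2"
    and X: "finite X" "card X \<le> 2" "\<And>r. r \<in> nbrs E t \<Longrightarrow> r \<notin> X \<Longrightarrow> card (nbrs E r) \<le> 3"
  shows "solvable E"
  unfolding solvable_def
proof (intro allI impI)
  fix W :: "int set"
  assume W: "finite W" "\<forall>x\<in>W. 0 < x" "card W = card E + 4"
  have neq': "t \<noteq> g" "t \<noteq> u" "u \<noteq> q" using edge_set_neq[OF E(1)] E by auto
  let ?G = "E - {{u, q}}"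
  let ?H = "?G - {{t, u}}"
  let ?F = "?H - {{t, g}}"
  have "{t, u} \<in> ?G" "{t, g} \<in> ?H" "edge_set ?G" "edge_set ?H"
    using E neq neq' by (auto simp: doubleton_eq_iff elim!: edge_set_subset)
  then have "card E = card ?F + 3"
    using card_remove_edge[OF E(1,4)] card_remove_edge[of ?G "{t, u}"] card_remove_edge[of ?H "{t, g}"]
    by linarith
  then have cW: "card W = card ?F + 3 + 4" using W(3) by simp
  obtain w N where w: "0 < N" "partial_weighting W ?F w {}" "\<forall>e\<in>?F. 0 < w e"
    "\<forall>e\<in>?F. w e \<le> N" "card {x \<in> W. N < x} = 3"
    using solvable_top_free[OF s W(1,2) cW] .
  then show "\<exists>w. partial_weighting W E w {}"
    using partial_weighting_add_three[OF E neq deg(1,2) X(1,2) _ _ _ _ _ W(1) _ _ w(2-4,1), of "{}"] X(3) deg(3) W(3)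
    by auto
qed

text \<open>A vertex \<open>g\<close> of degree 3 has one edge too many for
  \<open>partial_weighting_pivot\<close>. Removing \<open>{g, q'}\<close> as well cures this;
  \<open>g\<close> and \<open>q'\<close> are then postponed until that edge is inserted
  last.\<close>

lemma solvable_remove_four:
  assumes E: "edge_set E" "{t, g} \<in> E" "{t, u} \<in> E" "{u, q} \<in> E" "{g, q'} \<in> E"
    and neq: "t \<noteq> q" "u \<noteq> g" "g \<noteq> q" "q' \<noteq> t" "q' \<noteq> u" "q' \<noteq> q"
    and s: "solvable (E - {{g, q'}} - {{u, q}} - {{t, u}} - {{t, g}})"
    and deg: "card (nbrs E u) \<le> 3" "card (nbrs E q) \<le> 2" "card (nbrs E g) \<le> 3" "card (nbrs E q') \<le> 2"
    and X: "finite X" "card X \<le> 2" "\<And>r. r \<in> nbrs E t \<Longrightarrow> r \<notin> X \<Longrightarrow> card (nbrs E r) \<le> 3"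
  shows "solvable E"
  unfolding solvable_def
proof (intro allI impI)
  fix W :: "int set"
  assume W: "finite W" "\<forall>x\<in>W. 0 < x" "card W = card E + 4"
  have neq': "t \<noteq> g" "t \<noteq> u" "u \<noteq> q" "g \<noteq> q'" using edge_set_neq[OF E(1)] E by auto
  let ?K = "E - {{g, q'}}"
  let ?G = "?K - {{u, q}}"
  let ?H = "?G - {{t, u}}"
  let ?F = "?H - {{t, g}}"
  have K: "edge_set ?K" "{t, g} \<in> ?K" "{t, u} \<in> ?K" "{u, q} \<in> ?K"
    using E neq neq' by (auto simp: doubleton_eq_iff elim!: edge_set_subset)
  have "{t, u} \<in> ?G" "{t, g} \<in> ?H" "edge_set ?G" "edge_set ?H"
    using E neq neq' by (auto simp: doubleton_eq_iff elim!: edge_set_subset)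
  then have "card E = card ?F + 4" and cK: "card E = card ?K + 1"
    using card_remove_edge[OF E(1,5)] card_remove_edge[OF K(1,4)]
      card_remove_edge[of ?G "{t, u}"] card_remove_edge[of ?H "{t, g}"]
    by linarith+
  then have cW: "card W = card ?F + 4 + 4" using W(3) by simp
  obtain w N where w: "0 < N" "partial_weighting W ?F w {}" "\<forall>e\<in>?F. 0 < w e"
    "\<forall>e\<in>?F. w e \<le> N" "card {x \<in> W. N < x} = 4"
    using solvable_top_free[OF s W(1,2) cW] .
  have mono: "card (nbrs ?K v) \<le> card (nbrs E v)" for v
    by (rule card_nbrs_mono[OF E(1)]) auto
  have d: "card (nbrs ?K g) \<le> 2" "card (nbrs ?K q') \<le> 1"
    using deg by (simp_all add: card_nbrs_remove[OF E(1,5)])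
  have "card (nbrs ?K r) \<le> 3" if "r \<in> nbrs ?K t" "r \<notin> X" for r
  proof -
    have "r \<in> nbrs E t" using that(1) by (auto simp: nbrs_def)
    then show ?thesis using X(3)[of r] that(2) mono[of r] by linarith
  qed
  then obtain w' where w': "partial_weighting W ?K w' {g, q'}" "N < wsum ?K w' g"
    "\<forall>v. v \<notin> {t, u, q, g} \<longrightarrow> card (nbrs ?K v) \<le> 1 \<longrightarrow> wsum ?K w' v \<le> N"
    using partial_weighting_add_three[OF K neq(1-3) _ _ X(1,2) _ _ _ _ _ W(1) _ _ w(2-4,1), of "{g, q'}"]
      mono[of u] mono[of q] deg(1,2) neq neq' w(5) W(3) cK by auto
  \<comment> \<open>\<open>q'\<close> has at most one edge in \<open>?K\<close> and is none of the
    vertices that received new weights, so its sum stays below the one at \<open>g\<close>.\<close>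
  have "wsum ?K w' q' \<le> N" using w'(3) d(2) neq neq' by auto
  with w'(2) have "wsum ?K w' g \<noteq> wsum ?K w' q'" by linarith
  moreover have "card ?K + card ({} :: int set) + card (nbrs ?K g) + card (nbrs ?K q') < card W"
    using d cK W(3) by simp
  ultimately obtain a where "partial_weighting W (insert {g, q'} ?K) (w'({g, q'} := a)) {}"
    using partial_weighting_extend[OF K(1) neq'(4) _ _ W(1), of w' "{}" "{}"] w'(1) by auto
  then show "\<exists>w. partial_weighting W E w {}" using E(5) by (auto simp: insert_absorb)
qed

section \<open>Degeneracy and the structure of a minimal counterexample\<close>

definition two_degenerate :: "'a set set \<Rightarrow> bool" where
  "two_degenerate E \<longleftrightarrow> (\<forall>S. S \<subseteq> \<Union>E \<longrightarrow> S \<noteq> {} \<longrightarrow> (\<exists>v\<in>S. card (nbrs E v \<inter> S) \<le> 2))"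

lemma two_degenerate_subset:
  assumes "edge_set E" "two_degenerate E" "F \<subseteq> E"
  shows "two_degenerate F"
  unfolding two_degenerate_def
proof (intro allI impI)
  fix S assume S: "S \<subseteq> \<Union>F" "S \<noteq> {}"
  then obtain v where v: "v \<in> S" "card (nbrs E v \<inter> S) \<le> 2"
    using assms(2,3) unfolding two_degenerate_def by (metis Union_mono order_trans)
  have "card (nbrs F v \<inter> S) \<le> card (nbrs E v \<inter> S)"
    using finite_nbrs[OF assms(1)] assms(3) by (intro card_mono) (auto simp: nbrs_def)
  with v show "\<exists>v\<in>S. card (nbrs F v \<inter> S) \<le> 2" by force
qed

text \<open>In a minimal counterexample the reductions exclude local configurations, and degeneracy,
  applied to \<open>H\<close> and then to \<open>H - A\<close>, produces one of those around
  \<open>t\<close> nevertheless.\<close>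

lemma solvable_if_smaller_solvable:
  assumes E: "edge_set E" "two_degenerate E" and IH: "\<And>F. F \<subset> E \<Longrightarrow> solvable F"
  shows "solvable E"
proof (rule ccontr)
  assume contra: "\<not> solvable E"
  let ?d = "\<lambda>v. card (nbrs E v)"
  have nb: "{a, b} \<in> E" "{b, a} \<in> E" "a \<in> nbrs E b" "a \<noteq> b" if "b \<in> nbrs E a" for a b
    using that edge_set_neq[OF E(1), of a b] by (auto simp: nbrs_def insert_commute)
  have no_edge: False
    if "p \<in> nbrs E q" "?d q \<le> 2" "?d p \<le> 2 \<or> ?d q = 1 \<and> ?d p \<le> 5" for p q
  proof -
    have "solvable (E - {{p, q}})"
      using nb(2)[OF that(1)] by (intro IH) auto
    with contra solvable_remove_edge[OF E(1) nb(2)[OF that(1)] _ that(2,3)] show False by simp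
  qed
  have no_path: "5 < ?d a"
    if "b \<in> nbrs E a" "c \<in> nbrs E b" "a \<noteq> c" "?d b + ?d c \<le> 6" for a b c
  proof (rule ccontr)
    assume "\<not> 5 < ?d a"
    then have "?d a \<le> 5" by simp
    moreover have "solvable (E - {{b, c}} - {{a, b}})"
      using nb(1)[OF that(1)] by (intro IH) auto
    ultimately show False
      using contra solvable_remove_path[OF E(1) nb(1)[OF that(1)] nb(1)[OF that(2)] that(3) _ _ that(4)]
      by simp
  qed
  have no_two_low: False
    if "v \<in> nbrs E u" "v' \<in> nbrs E u" "v \<noteq> v'" "?d v \<le> 2" "?d v' \<le> 2"
      "card {r \<in> nbrs E u. 3 \<le> ?d r} \<le> 2" for u v v'
  proof -
    have "solvable (E - {{u, v'}} - {{u, v}})"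
      using nb(1)[OF that(1)] by (intro IH) auto
    then have "solvable E"
      by (rule solvable_remove_two_low[OF E(1) nb(1)[OF that(1)] nb(1)[OF that(2)] that(3) _ that(4,5) _ that(6)])
        (use finite_nbrs[OF E(1)] in auto)
    with contra show False by contradiction
  qed

  define H where "H = {v. 3 \<le> ?d v}"
  define A where "A = {u \<in> H. card (nbrs E u \<inter> H) \<le> 2}"
  have in_Union: "v \<in> \<Union>E" if "v \<in> H" for v
  proof -
    have "nbrs E v \<noteq> {}" using that unfolding H_def by (metis card.empty mem_Collect_eq not_numeral_le_zero)
    then show ?thesis by (auto simp: nbrs_def)
  qed
  \<comment> \<open>At most two neighbours lie in \<open>H\<close> and, by
    \<open>no_two_low\<close>, at most one outside; degree at least 3 forces equality in both. The
    low neighbour cannot have degree 1 by \<open>no_edge\<close>.\<close>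
  have A: "\<exists>q. q \<in> nbrs E u \<and> q \<notin> H \<and> ?d u = 3 \<and> ?d q = 2" if u: "u \<in> A" for u
  proof -
    let ?L = "nbrs E u - H"
    have fin: "finite (nbrs E u)" by (rule finite_nbrs[OF E(1)])
    have sum: "?d u = card (nbrs E u \<inter> H) + card ?L"
      using card_Int_Diff[OF fin] .
    have high: "card {r \<in> nbrs E u. 3 \<le> ?d r} \<le> 2"
      using u by (simp add: A_def H_def Int_def)
    have "card ?L \<le> 1"
    proof (rule ccontr)
      assume "\<not> card ?L \<le> 1"
      then obtain v v' where "v \<in> ?L" "v' \<in> ?L" "v \<noteq> v'"
        using fin by (metis One_nat_def card_le_Suc0_iff_eq finite_Diff)
      then show False using no_two_low[of v u v'] high by (auto simp: H_def)
    qed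
    with u sum have "card ?L = 1" "?d u = 3" by (auto simp: A_def H_def)
    then obtain q where q: "?L = {q}" by (auto simp: card_1_singleton_iff)
    then have "q \<in> nbrs E u" "q \<notin> H" by auto
    moreover have "0 < ?d q"
      using nb(3)[OF calculation(1)] finite_nbrs[OF E(1)] by (auto simp: card_gt_0_iff)
    moreover have "?d q \<noteq> 1"
      using no_edge[of u q] nb(3)[OF calculation(1)] \<open>?d u = 3\<close> by auto
    ultimately show ?thesis using \<open>?d u = 3\<close> by (auto simp: H_def)
  qed
  \<comment> \<open>The degrees of \<open>q\<close> and \<open>u\<close> add up to at most 2 + 3, so
    \<open>no_path\<close> applies to the path from \<open>y\<close> through \<open>q\<close> to
    \<open>u\<close>.\<close>
  have far: "5 < ?d y" if "u \<in> A" "q \<in> nbrs E u" "q \<notin> H" "y \<in> nbrs E q" "y \<noteq> u" for u q y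
    using no_path[of q y u] that A[of u] nb(3)[OF that(2)] nb(3)[OF that(4)] by (auto simp: H_def)

  have "H \<noteq> {}"
  proof
    assume H: "H = {}"
    have "E \<noteq> {}"
      using contra unfolding solvable_def partial_weighting_def distinguishing_off_def by auto
    then obtain e where e: "e \<in> E" by blast
    then have "card e = 2" using E(1) by (simp add: edge_set_def)
    then obtain p q where "e = {p, q}" by (auto simp: card_2_iff)
    then have "p \<in> nbrs E q" using e by (simp add: nbrs_def insert_commute)
    moreover have "?d x \<le> 2" for x
    proof -
      have "x \<notin> H" using H by blast
      then show ?thesis by (simp add: H_def)
    qed
    ultimately show False using no_edge by blast
  qed
  have core: "\<exists>v\<in>S. card (nbrs E v \<inter> S) \<le> 2" if "S \<subseteq> H" "S \<noteq> {}" for S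
  proof -
    have "S \<subseteq> \<Union>E" using that(1) in_Union by blast
    with that(2) show ?thesis using E(2) by (simp add: two_degenerate_def)
  qed
  obtain u0 where u0: "u0 \<in> A"
    using core[of H] \<open>H \<noteq> {}\<close> by (auto simp: A_def)
  \<comment> \<open>The second neighbour of \<open>q0\<close> has degree above 5, while vertices of
    \<open>A\<close> have degree 3; this shows that \<open>H - A\<close> is not empty.\<close>
  obtain q0 where q0: "q0 \<in> nbrs E u0" "q0 \<notin> H" "?d q0 = 2" using A[OF u0] by blast
  have "\<not> nbrs E q0 \<subseteq> {u0}"
    using q0(3) card_mono[of "{u0}" "nbrs E q0"] by auto
  then obtain y0 where "y0 \<in> nbrs E q0" "y0 \<noteq> u0" by blast
  then have "5 < ?d y0" using far[OF u0 q0(1,2)] by blast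
  then have "y0 \<in> H - A" using A[of y0] by (auto simp: H_def)
  then obtain t where t: "t \<in> H" "t \<notin> A" "card (nbrs E t \<inter> (H - A)) \<le> 2"
    using core[of "H - A"] by blast
  have fin: "finite (nbrs E t)" by (rule finite_nbrs[OF E(1)])
  \<comment> \<open>As \<open>t\<close> is not in \<open>A\<close>, it has at least three neighbours
    in \<open>H\<close>, but at most two of them are in \<open>H - A\<close>; so some neighbour is
    in \<open>A\<close>.\<close>
  have "\<not> nbrs E t \<inter> H \<subseteq> nbrs E t \<inter> (H - A)"
    using t card_mono[of "nbrs E t \<inter> (H - A)" "nbrs E t \<inter> H"] fin by (auto simp: A_def)
  then obtain u where u: "u \<in> nbrs E t" "u \<in> A" by blast
  obtain q where q: "q \<in> nbrs E u" "q \<notin> H" "?d u = 3" "?d q = 2" using A[OF u(2)] by blast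
  have tq: "t \<noteq> q" using t(1) q(2) by blast
  have "5 < ?d t" using no_path[OF u(1) q(1) tq] q by simp
  \<comment> \<open>At least 6 - 2 neighbours lie outside \<open>H - A\<close>, which leaves one
    besides \<open>u\<close> and \<open>q\<close>.\<close>
  then have "3 < card (nbrs E t - (H - A))"
    using card_Int_Diff[OF fin, of "H - A"] t(3) by linarith
  then have "\<not> nbrs E t - (H - A) \<subseteq> {u, q}"
    using card_mono[of "{u, q}" "nbrs E t - (H - A)"] by (auto simp: card_insert_if split: if_splits)
  then obtain g where g: "g \<in> nbrs E t" "g \<notin> H \<or> g \<in> A" "g \<noteq> u" "g \<noteq> q" by blast
  let ?X = "nbrs E t \<inter> (H - A)"
  have X: "finite ?X" "?d r \<le> 3" if "r \<in> nbrs E t" "r \<notin> ?X" for r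
    using that fin A[of r] by (auto simp: H_def)
  note edges = nb(1)[OF g(1)] nb(1)[OF u(1)] nb(1)[OF q(1)]
  show False
  proof (cases "g \<in> H")
    case False
    have "solvable (E - {{u, q}} - {{t, u}} - {{t, g}})"
      using edges by (intro IH) auto
    then have "solvable E"
      using solvable_remove_three[OF E(1) edges tq g(3)[symmetric] g(4), of ?X] q False t(3) fin X(2)
      by (auto simp: H_def)
    then show False using contra by blast
  next
    case True
    then have gA: "g \<in> A" using g(2) by blast
    obtain q' where q': "q' \<in> nbrs E g" "q' \<notin> H" "?d g = 3" "?d q' = 2" using A[OF gA] by blast
    have "q' \<noteq> t" "q' \<noteq> u" using q'(2) t(1) u(2) by (auto simp: A_def)
    \<comment> \<open>Otherwise \<open>g\<close> would be a second neighbour of \<open>q\<close>,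
      hence of degree above 5 by \<open>far\<close>, but its degree is 3.\<close>
    moreover have "q' \<noteq> q"
      using far[OF u(2) q(1,2), of g] nb(3)[OF q'(1)] g(3) q'(3) by auto
    moreover have "solvable (E - {{g, q'}} - {{u, q}} - {{t, u}} - {{t, g}})"
      using edges by (intro IH) auto
    ultimately have "solvable E"
      using solvable_remove_four[OF E(1) edges nb(1)[OF q'(1)] tq g(3)[symmetric] g(4), of ?X]
        q q' t(3) fin X(2) by auto
    then show False using contra by blast
  qed
qed

lemma two_degenerate_solvable:
  assumes "edge_set E" "two_degenerate E"
  shows "solvable E"
proof -
  have "finite E" using assms(1) by (simp add: edge_set_def)
  then show ?thesis using assms
  proof (induction E rule: finite_psubset_induct)
    case (psubset E)
    have "solvable F" if "F \<subset> E" for F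
      using psubset.IH[OF that] psubset.prems that edge_set_subset[of E F] two_degenerate_subset[of E F]
      by simp
    with psubset.prems show ?case by (rule solvable_if_smaller_solvable)
  qed
qed

section \<open>From edge sets back to graphs\<close>

lemma neighbours_eq_nbrs: "neighbours G = nbrs (edges G)"
  by (simp add: fun_eq_iff neighbours_def nbrs_def)

lemma weight_sum_eq_wsum: "weight_sum G = wsum (edges G)"
  by (simp add: fun_eq_iff weight_sum_def wsum_def neighbours_eq_nbrs)

lemma simple_graph_edge_set:
  assumes "simple_graph G"
  shows "edge_set (edges G)"
proof -
  have "edges G \<subseteq> Pow (verts G)" using assms by (auto simp: simple_graph_def)
  then show ?thesis
    using assms finite_subset unfolding simple_graph_def edge_set_def by auto
qed

lemma degenerate_two_degenerate:
  assumes G: "simple_graph G" and "degenerate 2 G"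
  shows "two_degenerate (edges G)"
  unfolding two_degenerate_def
proof (intro allI impI)
  fix S assume S: "S \<subseteq> \<Union>(edges G)" "S \<noteq> {}"
  \<comment> \<open>In the subgraph induced on \<open>S\<close>, degrees are exactly the numbers of
    neighbours inside \<open>S\<close>.\<close>
  let ?H = "(S, {e \<in> edges G. e \<subseteq> S})"
  have sub: "S \<subseteq> verts G" using S(1) G by (auto simp: simple_graph_def)
  then have "subgraph ?H G"
    using G finite_subset by (auto simp: subgraph_def simple_graph_def)
  then obtain v where v: "v \<in> S" "degree ?H v \<le> 2"
    using assms(2) S(2) unfolding degenerate_def by force
  have "nbrs (edges G) v \<inter> S = neighbours ?H v"
    using v(1) by (auto simp: neighbours_def nbrs_def)
  then show "\<exists>v\<in>S. card (nbrs (edges G) v \<inter> S) \<le> 2"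
    using v by (intro bexI[of _ v]) (auto simp: degree_def)
qed

text \<open>Nothing but \<open>u\<close> and \<open>v\<close> is reachable from \<open>u\<close>, so
  they span a component isomorphic to \<open>complete_graph 2\<close>. This rules out the exemption
  made in \<open>distinguishing_off\<close>.\<close>

lemma nice_not_isolated_edge:
  assumes G: "simple_graph G" "nice G" and uv: "nbrs (edges G) u = {v}" "nbrs (edges G) v = {u}"
  shows False
proof -
  have E: "edge_set (edges G)" by (rule simple_graph_edge_set[OF G(1)])
  have e: "{u, v} \<in> edges G" using uv(1) by (auto simp: nbrs_def)
  then have neq: "u \<noteq> v" and "u \<in> verts G"
    using edge_set_neq[OF E e] G(1) by (auto simp: simple_graph_def)
  have "x \<in> {u, v}" if "reachable G u x" for x
    using that unfolding reachable_def
  proof (induction rule: rtranclp_induct)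
    case (step y z)
    then have "z \<in> nbrs (edges G) y" by (simp add: nbrs_def)
    then show ?case using step.IH uv by auto
  qed simp
  moreover have "reachable G u u" "reachable G u v"
    using e by (auto simp: reachable_def)
  ultimately have reach: "{x. reachable G u x} = {u, v}" by blast
  define f where "f x = (if x = u then 0 else 1 :: nat)" for x
  have "bij_betw f {u, v} {..<2}"
    using neq by (auto simp: bij_betw_def f_def inj_on_def)
  moreover have "{u} \<notin> edges G" "{v} \<notin> edges G"
    using E by (auto simp: edge_set_def)
  moreover have "{0, Suc 0} \<subseteq> {..<2}" "card {0, Suc 0} = 2" by auto
  ultimately have "isomorphic (induced_subgraph G {u, v}) (complete_graph 2)"
    unfolding isomorphic_def using e neq
    by (intro exI[of _ f]) (auto simp: induced_subgraph_def complete_graph_def f_def insert_commute)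
  moreover have "induced_subgraph G {u, v} \<in> connected_components G"
    unfolding connected_components_def reach[symmetric] using \<open>u \<in> verts G\<close> by blast
  ultimately show False using G(2) by (auto simp: nice_def)
qed

theorem theorem5p1:
  fixes G :: "'a graph"
  assumes "simple_graph G" and "nice G" and "degenerate 2 G"
  shows "(\<forall>W :: int set. (\<forall>x\<in>W. 0 < x) \<and> finite W \<and> card W = card (edges G) + 4 \<longrightarrow>
            (\<exists>w. edge_weighting W G w \<and> edge_injective G w \<and> neighbour_sum_distinguishing G w))
         \<and> chi_sum_e1 G \<le> card (edges G) + 4"
proof
  have solv: "solvable (edges G)"
    using assms two_degenerate_solvable simple_graph_edge_set degenerate_two_degenerate by blast
  show *: "\<forall>W :: int set. (\<forall>x\<in>W. 0 < x) \<and> finite W \<and> card W = card (edges G) + 4 \<longrightarrow>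
    (\<exists>w. edge_weighting W G w \<and> edge_injective G w \<and> neighbour_sum_distinguishing G w)"
  proof (intro allI impI)
    fix W :: "int set"
    assume "(\<forall>x\<in>W. 0 < x) \<and> finite W \<and> card W = card (edges G) + 4"
    then obtain w where w: "partial_weighting W (edges G) w {}"
      using solv unfolding solvable_def by blast
    then have "neighbour_sum_distinguishing G w"
      using nice_not_isolated_edge[OF assms(1,2)]
      unfolding neighbour_sum_distinguishing_def weight_sum_eq_wsum
        partial_weighting_def distinguishing_off_def by blast
    then show "\<exists>w. edge_weighting W G w \<and> edge_injective G w \<and> neighbour_sum_distinguishing G w"
      using w by (auto simp: partial_weighting_def edge_weighting_def edge_injective_def)
  qed
  \<comment> \<open>The first part is applied to the integers from 1 to
    \<open>card (edges G) + 4\<close>.\<close>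
  show "chi_sum_e1 G \<le> card (edges G) + 4"
    unfolding chi_sum_e1_def
    by (intro Least_le *[rule_format]) auto
qed

end
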